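(* For the problem of scheduling with uncertain processing times on a single machine with the objective of minimizing the total completion time, the randomized algorithm $\beta$-RPCP with $\beta=2$ has expected competitive ratio at most $\frac{3(7+3\sqrt6)}{20}\le 2.152271$. Here, with $r_j=u_j/t_j$, job $j$ is tested with probability $\mathbb P_j=\frac{3r_j^2-3r_j}{3r_j^2-4r_j+3}$ for $1\le r_j\le 3$ (and with probability $0$ if $r_j<1$, probability $1$ if $r_j>3$).
   Context: Problem. There are $n$ jobs, all available at time $0$. Job $j$ has a testing time $t_j> 0$, an upper limit $u_j> 0$, and a real processing time $p_j\in[0,u_j]$. A job may be executed untested, which takes $u_j$ time units, or it may be tested (taking $t_j$ time units) and later executed in $p_j$ time units; other tasks may run between the test and the execution. A single machine runs one task at a time. The completion time of a job is the time at which its execution (or execution-untested) ends, and the cost of a schedule is the sum of the completion times of all jobs. An online algorithm knows all $t_j,u_j$ from the start, but learns $p_j$ only when the test of $j$ is finished. $\mathrm{OPT}$ knows all $p_j$ in advance (but must still test $j$ in order to run it in time $p_j$), and its cost is the minimum cost of any schedule. The expected competitive ratio of a randomized online algorithm $A$ is the smallest $c$ such that $\mathbb E[\mathrm{cost}(A)]\le c\cdot \mathrm{cost}(\mathrm{OPT})$ on all instances. Algorithm $\beta$-RPCP. Maintain a priority queue of tasks, smaller weight meaning higher priority (ties broken arbitrarily). Initially, for each job $j$, independently: with probability $\mathbb P_j$ insert a testing task of weight $\beta t_j$ (job $j$ is tested), and with probability $1-\mathbb P_j$ insert an execution-untested task of weight $u_j$ (job $j$ is not tested). While the queue is nonempty,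 extract a task of smallest weight and run it; if it was the testing task of job $j$, then after the test insert an execution task for $j$ with weight $t_j+p_j$ (running this execution task takes $p_j$ time). *)

theory Defs
  imports "HOL-Probability.Probability"
begin

text \<open>
  Jobs are the numbers below \<open>njobs\<close>; \<open>test_time\<close>, \<open>upper\<close> and \<open>proc_time\<close> are
  the parameters $t_j$, $u_j$ and $p_j$.
\<close>

record sched_inst =
  njobs :: nat
  test_time :: "nat \<Rightarrow> real"
  upper :: "nat \<Rightarrow> real"
  proc_time :: "nat \<Rightarrow> real"

definition jobs :: "sched_inst \<Rightarrow> nat set" where
  "jobs I = {..<njobs I}"

definition valid_inst :: "sched_inst \<Rightarrow> bool" where
  "valid_inst I \<longleftrightarrow>
     (\<forall>j\<in>jobs I. 0 < test_time I j \<and> 0 < upper I j \<and>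
        0 \<le> proc_time I j \<and> proc_time I j \<le> upper I j)"

datatype task = Test nat | Exec nat | Untested nat

fun duration :: "sched_inst \<Rightarrow> task \<Rightarrow> real" where
  "duration I (Test j) = test_time I j"
| "duration I (Exec j) = proc_time I j"
| "duration I (Untested j) = upper I j"

text \<open>
  A schedule consists of the set of tested jobs and the start times of the tasks; only the
  start times of the tasks in \<open>sched_tasks\<close> matter. Idle time is allowed.
\<close>

type_synonym schedule = "nat set \<times> (task \<Rightarrow> real)"

definition sched_tasks :: "sched_inst \<Rightarrow> nat set \<Rightarrow> task set" where
  "sched_tasks I T = Test ` T \<union> Exec ` T \<union> Untested ` (jobs I - T)"

definition feasible :: "sched_inst \<Rightarrow> schedule \<Rightarrow> bool" where
  "feasible I S \<longleftrightarrow> (case S of (T, s) \<Rightarrow>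
     T \<subseteq> jobs I \<and>
     (\<forall>a\<in>sched_tasks I T. 0 \<le> s a) \<and>
     (\<forall>a\<in>sched_tasks I T. \<forall>b\<in>sched_tasks I T. a \<noteq> b \<longrightarrow>
        s a + duration I a \<le> s b \<or> s b + duration I b \<le> s a) \<and>
     (\<forall>j\<in>T. s (Test j) + test_time I j \<le> s (Exec j)))"

definition completion_time :: "sched_inst \<Rightarrow> schedule \<Rightarrow> nat \<Rightarrow> real" where
  "completion_time I S j = (case S of (T, s) \<Rightarrow>
     (if j \<in> T then s (Exec j) + proc_time I j else s (Untested j) + upper I j))"

definition cost :: "sched_inst \<Rightarrow> schedule \<Rightarrow> real" where
  "cost I S = (\<Sum>j\<in>jobs I. completion_time I S j)"

definition opt_cost :: "sched_inst \<Rightarrow> real" where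
  "opt_cost I = Inf {cost I S | S. feasible I S}"

text \<open>
  A randomized algorithm is represented by the distribution of its schedule on each instance.
  The expectation is an extended nonnegative integral, so that an infinite expected cost
  is not mistaken for \<open>0\<close>; likewise an algorithm that is not competitive has ratio \<open>\<infinity>\<close>.
\<close>

type_synonym rand_alg = "sched_inst \<Rightarrow> schedule pmf"

definition expected_cost :: "rand_alg \<Rightarrow> sched_inst \<Rightarrow> ennreal" where
  "expected_cost A I = (\<integral>\<^sup>+ S. ennreal (cost I S) \<partial>measure_pmf (A I))"

definition expected_competitive_ratio :: "rand_alg \<Rightarrow> ennreal" where
  "expected_competitive_ratio A =
     Inf {c. \<forall>I. valid_inst I \<longrightarrow> expected_cost A I \<le> c * ennreal (opt_cost I)}"

fun weight :: "real \<Rightarrow> sched_inst \<Rightarrow> task \<Rightarrow> real" where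
  "weight \<beta> I (Test j) = \<beta> * test_time I j"
| "weight \<beta> I (Exec j) = test_time I j + proc_time I j"
| "weight \<beta> I (Untested j) = upper I j"

fun released :: "task \<Rightarrow> task set" where
  "released (Test j) = {Exec j}"
| "released (Exec j) = {}"
| "released (Untested j) = {}"

definition initial_queue :: "sched_inst \<Rightarrow> nat set \<Rightarrow> task set" where
  "initial_queue I T = Test ` T \<union> Untested ` (jobs I - T)"

text \<open>
  \<open>queue_run \<beta> I Q xs\<close>: started with queue \<open>Q\<close>, the priority queue loop can run the tasks
  in the order \<open>xs\<close>. The relation is nondeterministic because of ties.
\<close>

inductive queue_run :: "real \<Rightarrow> sched_inst \<Rightarrow> task set \<Rightarrow> task list \<Rightarrow> bool"
  for \<beta> :: real and I :: sched_inst where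
  stop: "queue_run \<beta> I {} []"
| pick: "a \<in> Q \<Longrightarrow> (\<And>b. b \<in> Q \<Longrightarrow> weight \<beta> I a \<le> weight \<beta> I b) \<Longrightarrow>
     queue_run \<beta> I ((Q - {a}) \<union> released a) xs \<Longrightarrow> queue_run \<beta> I Q (a # xs)"

text \<open>Start times when the tasks in the list (without repetitions) are run without idle time.\<close>

definition list_start :: "sched_inst \<Rightarrow> task list \<Rightarrow> task \<Rightarrow> real" where
  "list_start I xs a = sum_list (map (duration I) (takeWhile (\<lambda>b. b \<noteq> a) xs))"

definition test_set_pmf :: "sched_inst \<Rightarrow> (nat \<Rightarrow> real) \<Rightarrow> nat set pmf" where
  "test_set_pmf I P =
     map_pmf (\<lambda>b. {j. b j}) (Pi_pmf (jobs I) False (\<lambda>j. bernoulli_pmf (P j)))"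

text \<open>
  \<open>A\<close> is a version of the algorithm \<open>\<beta>\<close>-RPCP in which job \<open>j\<close> of instance \<open>I\<close> is tested
  with probability \<open>P I j\<close>. The way ties are broken is left completely open: it may depend
  on the instance and on the coin flips, and may itself be randomized.
\<close>

definition is_rpcp :: "real \<Rightarrow> (sched_inst \<Rightarrow> nat \<Rightarrow> real) \<Rightarrow> rand_alg \<Rightarrow> bool" where
  "is_rpcp \<beta> P A \<longleftrightarrow> (\<forall>I. valid_inst I \<longrightarrow>
     map_pmf fst (A I) = test_set_pmf I (P I) \<and>
     (\<forall>(T, s)\<in>set_pmf (A I).
        \<exists>xs. queue_run \<beta> I (initial_queue I T) xs \<and> s = list_start I xs))"

definition test_prob :: "sched_inst \<Rightarrow> nat \<Rightarrow> real" where
  "test_prob I j = (let r = upper I j / test_time I j in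
     if r < 1 then 0
     else if r \<le> 3 then (3 * r\<^sup>2 - 3 * r) / (3 * r\<^sup>2 - 4 * r + 3)
     else 1)"

end

theory Submission
  imports Defs
begin

text \<open>
  The total completion time is the sum over ordered pairs of jobs of the work spent on one of
  them before the other one completes. Whatever the coin of \<open>k\<close> shows, the jobs \<open>j\<close> and \<open>k\<close> delay
  each other in total by at most \<open>3/2 u\<^sub>j\<close> if \<open>j\<close> is not tested and by at most
  \<open>max (2 t\<^sub>j + p\<^sub>j) (3/2 (t\<^sub>j + p\<^sub>j))\<close> if \<open>j\<close> is tested. The expectation of this bound is at
  most \<open>c o\<^sub>j\<close>, where \<open>o\<^sub>j = min u\<^sub>j (t\<^sub>j + p\<^sub>j)\<close> and \<open>c\<close> is the claimed ratio. Charging each pair to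
  its job with the smaller \<open>o\<close> gives \<open>c\<close> times the sum of \<open>o\<^sub>j\<close> over all jobs and of
  \<open>min o\<^sub>j o\<^sub>k\<close> over all unordered pairs, which is a lower bound for the optimum.
\<close>

section \<open>Ratio for a single job\<close>

text \<open>The difference of the two sides is a nonnegative multiple of a square with root r = 1 +
  sqrt 6 / 3. Hence the constant is the exact maximum of 3/2 (3 r^2 - r) / (3 r^2 - 4 r + 3),
  attained there.\<close>

lemma three_halves_ratio_le:
  fixes r :: real
  shows "3 / 2 * (3 * r\<^sup>2 - r) \<le> 3 * (7 + 3 * sqrt 6) / 20 * (3 * r\<^sup>2 - 4 * r + 3)"
proof -
  define w where "w = sqrt 6"
  have w: "w * (w * z) = 6 * z" for z
    by (simp add: w_def flip: mult.assoc)
  have "3 * (7 + 3 * w) / 20 * (3 * r\<^sup>2 - 4 * r + 3) - 3 / 2 * (3 * r\<^sup>2 - r)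
      = 27 * (w - 1) / 20 * (r - (1 + w / 3))\<^sup>2"
    by (simp add: power2_eq_square field_simps w)
  moreover have "1 \<le> w"
    by (simp add: w_def)
  ultimately show ?thesis
    by (smt (verit) w_def divide_nonneg_nonneg mult_nonneg_nonneg zero_le_power2)
qed

lemma sqrt_6_bounds: "(2.449489 :: real) \<le> sqrt 6" "sqrt 6 \<le> (2.4494899 :: real)"
  by (rule real_le_rsqrt real_le_lsqrt; simp add: power2_eq_square)+

definition rpcp_ratio :: real where
  "rpcp_ratio = 3 * (7 + 3 * sqrt 6) / 20"

lemma rpcp_ratio_ge_2: "2 \<le> rpcp_ratio"
  using sqrt_6_bounds by (simp add: rpcp_ratio_def)

text \<open>\<open>test_prob\<close> depends on a job only through u/t; this form allows scaling
  every test time to 1.\<close>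

definition prob_of_ratio :: "real \<Rightarrow> real" where
  "prob_of_ratio r = (if r < 1 then 0
     else if r \<le> 3 then (3 * r\<^sup>2 - 3 * r) / (3 * r\<^sup>2 - 4 * r + 3) else 1)"

lemma test_prob_eq: "test_prob I j = prob_of_ratio (upper I j / test_time I j)"
  by (simp add: test_prob_def prob_of_ratio_def Let_def)

lemma prob_of_ratio_denom_pos: "0 < 3 * r\<^sup>2 - 4 * r + (3 :: real)"
proof -
  have "3 * r\<^sup>2 - 4 * r + 3 = 3 * (r - 2 / 3)\<^sup>2 + 5 / 3"
    by (simp add: power2_eq_square field_simps)
  then show ?thesis
    by (smt (verit) zero_le_power2 divide_pos_pos)
qed

lemma prob_of_ratio_nonneg: "0 \<le> prob_of_ratio r"
  using prob_of_ratio_denom_pos[of r]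
  by (auto simp: prob_of_ratio_def power2_eq_square intro!: divide_nonneg_pos)

text \<open>Numerator minus denominator is r - 3, so the formula reaches 1 exactly at the threshold
  r = 3.\<close>

lemma prob_of_ratio_le_1: "prob_of_ratio r \<le> 1"
  using prob_of_ratio_denom_pos[of r] by (auto simp: prob_of_ratio_def)

text \<open>
  The two inequalities are the cases \<open>p = u\<close> and \<open>p = 0\<close>; for \<open>1 \<le> r \<le> 3\<close> they are
  the same inequality, which is how \<^const>\<open>test_prob\<close> is chosen.
\<close>

lemma prob_of_ratio_extremal:
  assumes "0 < r"
  shows "3 / 2 * (r + prob_of_ratio r) \<le> rpcp_ratio * r"
    and "2 * prob_of_ratio r + (1 - prob_of_ratio r) * (3 / 2 * r) \<le> rpcp_ratio"
proof -
  have "3 / 2 * (r + prob_of_ratio r) \<le> rpcp_ratio * r \<and>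
    2 * prob_of_ratio r + (1 - prob_of_ratio r) * (3 / 2 * r) \<le> rpcp_ratio"
  proof (cases "1 \<le> r \<and> r \<le> 3")
    case True
    define D where "D = 3 * r\<^sup>2 - 4 * r + 3"
    have D: "0 < D"
      using prob_of_ratio_denom_pos by (simp add: D_def)
    have P: "prob_of_ratio r = (3 * r\<^sup>2 - 3 * r) / D"
      using True by (simp add: prob_of_ratio_def D_def)
    have key: "3 / 2 * (3 * r\<^sup>2 - r) / D \<le> rpcp_ratio"
      using three_halves_ratio_le[of r] D unfolding rpcp_ratio_def D_def
      by (subst pos_divide_le_eq) auto
    have "3 / 2 * (r + prob_of_ratio r) = 3 / 2 * (3 * r\<^sup>2 - r) / D * r"
      unfolding P using D by (simp add: field_simps) (simp add: D_def power2_eq_square algebra_simps)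
    moreover have "2 * prob_of_ratio r + (1 - prob_of_ratio r) * (3 / 2 * r)
        = 3 / 2 * (3 * r\<^sup>2 - r) / D"
      unfolding P using D by (simp add: field_simps) (simp add: D_def power2_eq_square algebra_simps)
    ultimately show ?thesis
      using key mult_right_mono[OF key, of r] assms by auto
  next
    case False
    have "2 * r \<le> rpcp_ratio * r"
      using rpcp_ratio_ge_2 assms by (intro mult_right_mono) auto
    have "3 / 2 * (r + 1) \<le> rpcp_ratio * r" if "3 < r"
      using that by (intro order_trans[OF _ \<open>2 * r \<le> rpcp_ratio * r\<close>]) simp
    with False show ?thesis
      using rpcp_ratio_ge_2 assms by (auto simp: prob_of_ratio_def)
  qed
  then show "3 / 2 * (r + prob_of_ratio r) \<le> rpcp_ratio * r"
    and "2 * prob_of_ratio r + (1 - prob_of_ratio r) * (3 / 2 * r) \<le> rpcp_ratio"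
    by auto
qed

text \<open>Here q stands for p/t. The left side grows with q at a rate of at most 3/2: against c r
  the worst case is q = r, and against c (1 + q), whose slope is c >= 2, it is q = 0. These are the
  two extremal inequalities.\<close>

lemma single_job_ratio_normalized:
  fixes r q :: real
  assumes "0 < r" "0 \<le> q" "q \<le> r"
  shows "prob_of_ratio r * max (2 + q) (3 / 2 * (1 + q)) + (1 - prob_of_ratio r) * (3 / 2 * r)
    \<le> rpcp_ratio * min r (1 + q)"
proof -
  let ?P = "prob_of_ratio r" and ?c = rpcp_ratio
  note P = prob_of_ratio_nonneg[of r] prob_of_ratio_le_1[of r]
  note ext = prob_of_ratio_extremal[OF assms(1)]
  have Pq: "?P * q \<le> q" "?P * q \<le> ?P * r"
    using P assms by (auto intro: mult_left_le_one_le mult_left_mono)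
  have cq: "2 * q \<le> ?c * q"
    using rpcp_ratio_ge_2 assms by (intro mult_right_mono) auto
  \<comment> \<open>At q = r the branch 2 + q exceeds 3/2 (1 + q) by (1 - r)/2. This is positive
    only for r < 1, where P vanishes.\<close>
  have Pr: "?P \<le> ?P * r"
    using P by (cases "r < 1") (auto simp: prob_of_ratio_def mult_le_cancel_left1)
  have "?P * (2 + q) + (1 - ?P) * (3 / 2 * r) \<le> ?c * r"
    and "?P * (3 / 2 * (1 + q)) + (1 - ?P) * (3 / 2 * r) \<le> ?c * r"
    and "?P * (2 + q) + (1 - ?P) * (3 / 2 * r) \<le> ?c * (1 + q)"
    and "?P * (3 / 2 * (1 + q)) + (1 - ?P) * (3 / 2 * r) \<le> ?c * (1 + q)"
    using ext Pq cq Pr P assms unfolding distrib_left left_diff_distrib by (simp_all)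
  then show ?thesis
    by (auto simp: max_def min_def)
qed

section \<open>Optimal schedules\<close>

text \<open>Induction by increasing start time: the intervals other than the last one end before it
  starts, so the induction hypothesis applies to them with \<open>s a\<close> in place of x.\<close>

lemma sum_durations_le:
  fixes s d :: "'a \<Rightarrow> real"
  assumes "finite A" "0 \<le> x" "\<And>a. a \<in> A \<Longrightarrow> 0 \<le> s a \<and> 0 \<le> d a \<and> s a + d a \<le> x"
    and "\<And>a b. a \<in> A \<Longrightarrow> b \<in> A \<Longrightarrow> a \<noteq> b \<Longrightarrow> s a + d a \<le> s b \<or> s b + d b \<le> s a"
  shows "sum d A \<le> x"
  using assms
proof (induction A arbitrary: x rule: finite_ranking_induct[where f = s])
  case empty
  then show ?case by simp
next
  case (insert a A)
  show ?case
  \<comment> \<open>An empty interval may share its start with a longer one that ends after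
    \<open>s a\<close>; dropping it changes no sum.\<close>
  proof (cases "a \<in> A \<or> d a = 0")
    case True
    then have "sum d (insert a A) = sum d A"
      using insert.hyps by (auto simp: sum.insert_if)
    with insert.IH[of x] insert.prems show ?thesis by auto
  next
    case False
    have "s b + d b \<le> s a" if "b \<in> A" for b
      using insert.hyps(2)[OF that] insert.prems(2)[of a] insert.prems(3)[of a b] that False
      by force
    with insert.IH[of "s a"] insert.prems have "sum d A \<le> s a" by auto
    with insert.prems(2)[of a] False insert.hyps show ?thesis by auto
  qed
qed

text \<open>Serves both cost bounds: the diagonal is compared job by job, the rest by unordered
  pairs.\<close>

lemma sum_square_eq_sum_pairs:
  fixes f :: "nat \<Rightarrow> nat \<Rightarrow> 'a :: comm_monoid_add"
  shows "(\<Sum>j<n. \<Sum>k<n. f j k) = (\<Sum>j<n. f j j) + (\<Sum>j<n. \<Sum>k<j. f j k + f k j)"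
  by (induction n) (simp_all add: sum.distrib ac_simps)

definition opt_time :: "sched_inst \<Rightarrow> nat \<Rightarrow> real" where
  "opt_time I j = min (upper I j) (test_time I j + proc_time I j)"

definition job_tasks :: "nat set \<Rightarrow> nat \<Rightarrow> task set" where
  "job_tasks T j = (if j \<in> T then {Test j, Exec j} else {Untested j})"

definition final_task :: "nat set \<Rightarrow> nat \<Rightarrow> task" where
  "final_task T j = (if j \<in> T then Exec j else Untested j)"

lemma sched_tasks_eq: "T \<subseteq> jobs I \<Longrightarrow> sched_tasks I T = (\<Union>j\<in>jobs I. job_tasks T j)"
  by (auto simp: sched_tasks_def job_tasks_def split: if_splits)

lemma finite_jobs [simp]: "finite (jobs I)"
  by (simp add: jobs_def)

lemma sum_job_tasks:
  "finite J \<Longrightarrow> (\<Sum>a\<in>(\<Union>j\<in>J. job_tasks T j). f a) = (\<Sum>j\<in>J. \<Sum>a\<in>job_tasks T j. f a)"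
  by (rule sum.UNION_disjoint) (auto simp: job_tasks_def split: if_splits)

lemma completion_time_eq:
  "completion_time I (T, s) j = s (final_task T j) + duration I (final_task T j)"
  by (simp add: completion_time_def final_task_def)

lemma duration_nonneg: "valid_inst I \<Longrightarrow> T \<subseteq> jobs I \<Longrightarrow> a \<in> sched_tasks I T \<Longrightarrow> 0 \<le> duration I a"
  by (auto simp: sched_tasks_def valid_inst_def less_imp_le)

text \<open>All tasks of the jobs completed no later than j fit disjointly into the time up to the
  completion of j, and each such job occupies at least its \<open>opt_time\<close>.\<close>

lemma sum_opt_time_le_completion_time:
  assumes valid: "valid_inst I" and feas: "feasible I (T, s)" and j: "j \<in> jobs I"
  shows "(\<Sum>k | k \<in> jobs I \<and> completion_time I (T, s) k \<le> completion_time I (T, s) j. opt_time I k)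
    \<le> completion_time I (T, s) j"
proof -
  let ?C = "completion_time I (T, s)"
  let ?J = "{k \<in> jobs I. ?C k \<le> ?C j}"
  let ?A = "\<Union>k\<in>?J. job_tasks T k"
  have T: "T \<subseteq> jobs I"
    using feas by (simp add: feasible_def)
  have A: "?A \<subseteq> sched_tasks I T"
    unfolding sched_tasks_eq[OF T] by blast
  have "(\<Sum>k\<in>?J. opt_time I k) \<le> (\<Sum>k\<in>?J. \<Sum>a\<in>job_tasks T k. duration I a)"
    by (intro sum_mono) (auto simp: opt_time_def job_tasks_def)
  also have "\<dots> = (\<Sum>a\<in>?A. duration I a)"
    by (rule sum_job_tasks[symmetric]) auto
  also have "\<dots> \<le> ?C j"
  proof (rule sum_durations_le[where s = s])
    show "finite ?A"
      by (auto simp: job_tasks_def)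
    have "final_task T j \<in> sched_tasks I T"
      using j T by (auto simp: sched_tasks_def final_task_def)
    then show "0 \<le> ?C j"
      unfolding completion_time_eq using feas duration_nonneg[OF valid T]
      by (simp add: feasible_def)
    show "0 \<le> s a \<and> 0 \<le> duration I a \<and> s a + duration I a \<le> ?C j" if a: "a \<in> ?A" for a
    proof -
      obtain k where k: "k \<in> jobs I" "?C k \<le> ?C j" "a \<in> job_tasks T k"
        using a by auto
      have "s a + duration I a \<le> ?C k"
        using k(1,3) feas valid T
        by (auto simp: job_tasks_def completion_time_def feasible_def valid_inst_def split: if_splits)
          (smt (verit))
      then show ?thesis
        using k(2) a A feas duration_nonneg[OF valid T, of a] by (auto simp: feasible_def)
    qed
    show "s a + duration I a \<le> s b \<or> s b + duration I b \<le> s a"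
      if "a \<in> ?A" "b \<in> ?A" "a \<noteq> b" for a b
      using that feas subsetD[OF A] unfolding feasible_def by blast
  qed
  finally show ?thesis .
qed

lemma opt_time_pos: "valid_inst I \<Longrightarrow> j \<in> jobs I \<Longrightarrow> 0 < opt_time I j"
  by (force simp: valid_inst_def opt_time_def)

text \<open>This is the cost of the shortest-processing-time order for jobs of lengths
  \<open>opt_time\<close>.\<close>

definition opt_bound :: "sched_inst \<Rightarrow> real" where
  "opt_bound I = (\<Sum>j<njobs I. opt_time I j) + (\<Sum>j<njobs I. \<Sum>k<j. min (opt_time I j) (opt_time I k))"

lemma opt_bound_le_cost:
  assumes valid: "valid_inst I" and feas: "feasible I S"
  shows "opt_bound I \<le> cost I S"
proof -
  obtain T s where S: "S = (T, s)" by force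
  let ?C = "completion_time I S" and ?o = "opt_time I"
  \<comment> \<open>For each pair at least one of \<open>?f j k\<close> and \<open>?f k j\<close> is
    a full \<open>opt_time\<close>, hence at least the minimum of the two.\<close>
  let ?f = "\<lambda>j k. if ?C k \<le> ?C j then ?o k else 0"
  have o: "0 < ?o j" if "j < njobs I" for j
    using opt_time_pos[OF valid] that by (simp add: jobs_def)
  have "opt_bound I \<le> (\<Sum>j<njobs I. ?f j j) + (\<Sum>j<njobs I. \<Sum>k<j. ?f j k + ?f k j)"
    unfolding opt_bound_def using o
    by (intro add_mono sum_mono) (auto simp: less_imp_le min_le_iff_disj dest: less_trans)
  also have "\<dots> = (\<Sum>j<njobs I. \<Sum>k<njobs I. ?f j k)"
    by (rule sum_square_eq_sum_pairs[symmetric])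
  also have "\<dots> \<le> cost I S"
    unfolding cost_def jobs_def
  proof (rule sum_mono)
    fix j assume "j \<in> {..<njobs I}"
    then show "(\<Sum>k<njobs I. ?f j k) \<le> ?C j"
      using sum_opt_time_le_completion_time[OF valid feas[unfolded S], of j]
      by (simp add: S jobs_def sum.If_cases Collect_conj_eq lessThan_def)
  qed
  finally show ?thesis .
qed

text \<open>Bounding the real infimum \<open>opt_cost\<close> from below requires a nonempty set of
  costs. Running all jobs untested in index order provides a schedule.\<close>

lemma feasible_exists:
  assumes "valid_inst I"
  shows "\<exists>S. feasible I S"
proof -
  define s where "s a = (case a of Untested j \<Rightarrow> sum (upper I) {..<j} | _ \<Rightarrow> 0)" for a
  have step: "sum (upper I) {..<j} + upper I j \<le> sum (upper I) {..<k}"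
    if "j < k" "k < njobs I" for j k
  proof -
    have "sum (upper I) {..<Suc j} \<le> sum (upper I) {..<k}"
      using that assms by (intro sum_mono2) (auto simp: valid_inst_def jobs_def less_imp_le)
    then show ?thesis by simp
  qed
  have nonneg: "0 \<le> sum (upper I) {..<j}" if "j < njobs I" for j
    using that assms by (intro sum_nonneg) (auto simp: valid_inst_def jobs_def less_imp_le)
  have "sum (upper I) {..<j} + upper I j \<le> sum (upper I) {..<k} \<or>
      sum (upper I) {..<k} + upper I k \<le> sum (upper I) {..<j}"
    if "j < njobs I" "k < njobs I" "j \<noteq> k" for j k
    using step[of j k] step[of k j] that by linarith
  then have "feasible I ({}, s)"
    using nonneg by (simp add: feasible_def sched_tasks_def s_def jobs_def)
  then show ?thesis ..
qed

lemma opt_bound_le_opt_cost: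
  assumes "valid_inst I"
  shows "opt_bound I \<le> opt_cost I"
  unfolding opt_cost_def
  using feasible_exists[OF assms] opt_bound_le_cost[OF assms]
  by (intro cInf_greatest) auto


section \<open>Runs of the priority queue\<close>

text \<open>Uses the same \<open>takeWhile\<close> as \<open>list_start\<close>, so that start times
  become sums over smaller positions.\<close>

definition position :: "'a list \<Rightarrow> 'a \<Rightarrow> nat" where
  "position xs a = length (takeWhile (\<lambda>b. b \<noteq> a) xs)"

lemma position_simps [simp]:
  "position [] a = 0"
  "position (x # xs) a = (if x = a then 0 else Suc (position xs a))"
  by (simp_all add: position_def)

lemma position_eq_iff: "a \<in> set xs \<Longrightarrow> b \<in> set xs \<Longrightarrow> position xs a = position xs b \<longleftrightarrow> a = b"
  by (induction xs) auto

lemma list_start_eq_sum: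
  "distinct xs \<Longrightarrow> list_start I xs b = (\<Sum>a | a \<in> set xs \<and> position xs a < position xs b. duration I a)"
proof (induction xs)
  case Nil
  then show ?case by (simp add: list_start_def)
next
  case (Cons x xs)
  show ?case
  proof (cases "x = b")
    case True
    then show ?thesis by (simp add: list_start_def)
  next
    case False
    have "{a. a \<in> set (x # xs) \<and> position (x # xs) a < position (x # xs) b}
        = insert x {a. a \<in> set xs \<and> position xs a < position xs b}"
      using False Cons.prems by auto
    moreover have "list_start I (x # xs) b = duration I x + list_start I xs b"
      using False by (simp add: list_start_def)
    ultimately show ?thesis
      using Cons by simp
  qed
qed

lemma list_start_plus_duration:
  assumes "distinct xs" "b \<in> set xs"
  shows "list_start I xs b + duration I b
    = (\<Sum>a | a \<in> set xs \<and> position xs a \<le> position xs b. duration I a)"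
proof -
  have "{a. a \<in> set xs \<and> position xs a \<le> position xs b}
      = insert b {a. a \<in> set xs \<and> position xs a < position xs b}"
    using position_eq_iff[OF _ assms(2)] assms(2) by (auto simp: le_less)
  then show ?thesis
    using list_start_eq_sum[OF assms(1), of I b] by simp
qed

text \<open>Invariant of the loop: it prevents an execution from being queued before its release,
  and so makes the run free of repetitions.\<close>

definition consistent_queue :: "task set \<Rightarrow> bool" where
  "consistent_queue Q \<longleftrightarrow> (\<forall>j. Test j \<in> Q \<longrightarrow> Exec j \<notin> Q)"

lemma consistent_queue_step:
  "consistent_queue Q \<Longrightarrow> a \<in> Q \<Longrightarrow> consistent_queue ((Q - {a}) \<union> released a)"
  by (cases a) (auto simp: consistent_queue_def)

lemma queue_run_tasks:
  assumes "queue_run \<beta> I Q xs" "consistent_queue Q"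
  shows "distinct xs \<and> set xs = Q \<union> {Exec j | j. Test j \<in> Q}"
  using assms
proof (induction rule: queue_run.induct)
  case stop
  then show ?case by simp
next
  case (pick a Q xs)
  have "distinct xs \<and> set xs =
      (Q - {a} \<union> released a) \<union> {Exec j | j. Test j \<in> (Q - {a} \<union> released a)}"
    using pick.IH consistent_queue_step pick.prems pick.hyps(1) by blast
  then show ?case
    using pick.hyps(1) pick.prems by (cases a) (auto simp: consistent_queue_def)
qed

lemma queue_run_test_before_exec:
  assumes "queue_run \<beta> I Q xs" "consistent_queue Q" "Test j \<in> Q"
  shows "position xs (Test j) < position xs (Exec j)"
  using assms
proof (induction rule: queue_run.induct)
  case stop
  then show ?case by simp
next
  case (pick a Q xs)
  have "consistent_queue (Q - {a} \<union> released a)"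
    using consistent_queue_step pick.prems pick.hyps(1) by blast
  then show ?case
    using pick by (auto simp: consistent_queue_def)
qed

text \<open>
  The last premise says that \<open>b\<close> is already in the queue when \<open>a\<close> is extracted.
\<close>

lemma queue_run_weight_le:
  assumes "queue_run \<beta> I Q xs" "consistent_queue Q" "b \<in> set xs" "position xs a < position xs b"
    and "\<And>j. b = Exec j \<Longrightarrow> Exec j \<in> Q \<or> position xs (Test j) < position xs a"
  shows "weight \<beta> I a \<le> weight \<beta> I b"
  using assms
proof (induction rule: queue_run.induct)
  case stop
  then show ?case by simp
next
  case (pick x Q xs)
  have Q': "consistent_queue (Q - {x} \<union> released x)"
    using consistent_queue_step pick.prems pick.hyps(1) by blast
  have set_eq: "set (x # xs) = Q \<union> {Exec j | j. Test j \<in> Q}"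
    using queue_run_tasks[OF queue_run.pick[OF pick.hyps] pick.prems(1)] by blast
  have b: "b \<noteq> x"
    using pick.prems(3) by auto
  show ?case
  proof (cases "a = x")
    case True
    \<comment> \<open>No position lies below that of the head, so the last premise puts an execution
      \<open>b\<close> into the queue; any other task of the run is in \<open>Q\<close>
      anyway.\<close>
    then have "b \<in> Q"
      using pick.prems(2,4) set_eq by auto
    with True show ?thesis
      using pick.hyps(2) by blast
  next
    case False
    show ?thesis
    proof (rule pick.IH[OF Q'])
      show "b \<in> set xs"
        using pick.prems(2) b by simp
      show "position xs a < position xs b"
        using pick.prems(3) False b by simp
      \<comment> \<open>If \<open>x\<close> is \<open>Test j\<close>, it has just released
        \<open>Exec j\<close>; otherwise all positions concerned shift by one.\<close>
      show "Exec j \<in> Q - {x} \<union> released x \<or> position xs (Test j) < position xs a" if "b = Exec j" for j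
        using pick.prems(4)[OF that] that b False by (auto split: if_splits)
    qed
  qed
qed

lemma consistent_initial_queue: "consistent_queue (initial_queue I T)"
  by (auto simp: consistent_queue_def initial_queue_def)

lemma initial_queue_run_tasks:
  assumes "queue_run \<beta> I (initial_queue I T) xs"
  shows "distinct xs \<and> set xs = sched_tasks I T"
  using queue_run_tasks[OF assms consistent_initial_queue]
  by (auto simp: initial_queue_def sched_tasks_def)

section \<open>Mutual delay of two jobs in a run\<close>

definition work_before :: "sched_inst \<Rightarrow> nat set \<Rightarrow> task list \<Rightarrow> nat \<Rightarrow> nat \<Rightarrow> real" where
  "work_before I T xs j k =
     (\<Sum>a\<in>job_tasks T k. if position xs a \<le> position xs (final_task T j) then duration I a else 0)"

lemma work_before_tested:
  "k \<in> T \<Longrightarrow> work_before I T xs j k =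
     (if position xs (Test k) \<le> position xs (final_task T j) then test_time I k else 0) +
     (if position xs (Exec k) \<le> position xs (final_task T j) then proc_time I k else 0)"
  by (simp add: work_before_def job_tasks_def)

lemma work_before_untested:
  "k \<notin> T \<Longrightarrow> work_before I T xs j k =
     (if position xs (Untested k) \<le> position xs (final_task T j) then upper I k else 0)"
  by (simp add: work_before_def job_tasks_def)

text \<open>A run has no idle time, so each completion time splits into the shares of work spent on
  the individual jobs.\<close>

lemma cost_queue_run:
  assumes T: "T \<subseteq> jobs I" and run: "queue_run \<beta> I (initial_queue I T) xs"
  shows "cost I (T, list_start I xs) = (\<Sum>j<njobs I. \<Sum>k<njobs I. work_before I T xs j k)"
  unfolding cost_def jobs_def
proof (rule sum.cong)
  fix j assume "j \<in> {..<njobs I}"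
  then have j: "j \<in> jobs I"
    by (simp add: jobs_def)
  have xs: "distinct xs" "set xs = sched_tasks I T"
    using initial_queue_run_tasks[OF run] by auto
  have "final_task T j \<in> set xs"
    using j by (auto simp: xs sched_tasks_def final_task_def)
  then have "completion_time I (T, list_start I xs) j
      = (\<Sum>a | a \<in> set xs \<and> position xs a \<le> position xs (final_task T j). duration I a)"
    unfolding completion_time_eq by (rule list_start_plus_duration[OF xs(1)])
  also have "\<dots> = (\<Sum>a\<in>set xs. if position xs a \<le> position xs (final_task T j) then duration I a else 0)"
    by (simp add: sum.inter_filter)
  also have "\<dots> = (\<Sum>k\<in>jobs I. \<Sum>a\<in>job_tasks T k.
      if position xs a \<le> position xs (final_task T j) then duration I a else 0)"
    unfolding xs(2) sched_tasks_eq[OF T] by (rule sum_job_tasks) simp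
  also have "\<dots> = (\<Sum>k\<in>jobs I. work_before I T xs j k)"
    unfolding work_before_def ..
  finally show "completion_time I (T, list_start I xs) j = (\<Sum>k<njobs I. work_before I T xs j k)"
    by (simp add: jobs_def)
qed simp

text \<open>Depends on \<open>T\<close> only through the coin of \<open>j\<close>, so its
  expectation involves a single coin.\<close>

definition job_bound :: "sched_inst \<Rightarrow> nat set \<Rightarrow> nat \<Rightarrow> real" where
  "job_bound I T j =
     (if j \<in> T
      then max (2 * test_time I j + proc_time I j) (3 / 2 * (test_time I j + proc_time I j))
      else 3 / 2 * upper I j)"

lemma job_bound_nonneg: "valid_inst I \<Longrightarrow> j \<in> jobs I \<Longrightarrow> 0 \<le> job_bound I T j"
  by (force simp: job_bound_def valid_inst_def)

lemma work_before_self_le: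
  assumes "valid_inst I" "j \<in> jobs I"
  shows "work_before I T xs j j \<le> job_bound I T j"
  using assms
  by (cases "j \<in> T") (auto simp: work_before_tested work_before_untested job_bound_def valid_inst_def)

text \<open>A task extracted while a task of j waits has at most the weight of the latter. An
  execution weighs as much as the whole work on its tested job, and a test weighs twice its length.
  So a test of k that overtakes a task of j adds at most half the weight of that task, whence the
  factor 3/2.\<close>

lemma work_before_pair_le:
  assumes valid: "valid_inst I" and j: "j \<in> jobs I" and k: "k \<in> jobs I" and "j \<noteq> k"
    and T: "T \<subseteq> jobs I" and run: "queue_run 2 I (initial_queue I T) xs"
  shows "work_before I T xs j k + work_before I T xs k j \<le> job_bound I T j"
proof -
  note w = queue_run_weight_le[OF run consistent_initial_queue]
  have xs: "set xs = sched_tasks I T"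
    using initial_queue_run_tasks[OF run] by auto
  have no_exec: "Exec i \<notin> initial_queue I T" for i
    by (auto simp: initial_queue_def)
  have wT: "weight 2 I a \<le> 2 * test_time I i" if "position xs a < position xs (Test i)" "i \<in> T" for a i
    using w[of "Test i" a] that by (simp add: xs sched_tasks_def)
  have wU: "weight 2 I a \<le> upper I i"
    if "position xs a < position xs (Untested i)" "i \<notin> T" "i \<in> jobs I" for a i
    using w[of "Untested i" a] that by (simp add: xs sched_tasks_def)
  have wE: "weight 2 I a \<le> test_time I i + proc_time I i"
    if "position xs (Test i) < position xs a" "position xs a < position xs (Exec i)" "i \<in> T" for a i
    using w[of "Exec i" a] that by (simp add: xs sched_tasks_def)
  have TE: "position xs (Test i) < position xs (Exec i)" if "i \<in> T" for i
    using queue_run_test_before_exec[OF run consistent_initial_queue] that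
    by (simp add: initial_queue_def)
  have pos: "0 < test_time I i" "0 \<le> proc_time I i" "0 < upper I i" if "i \<in> jobs I" for i
    using valid that by (auto simp: valid_inst_def)
  note pos = pos[OF j] pos[OF k]
  have neq: "position xs a \<noteq> position xs b"
    if "a \<in> job_tasks T j" "b \<in> job_tasks T k" for a b
    using that position_eq_iff[of a xs b] \<open>j \<noteq> k\<close> j k unfolding xs sched_tasks_eq[OF T]
    by (force simp: job_tasks_def split: if_splits)
  show ?thesis
  proof (cases "j \<in> T"; cases "k \<in> T")
    assume jk: "j \<in> T" "k \<in> T"
    note [simp] = work_before_tested[OF jk(1)] work_before_tested[OF jk(2)]
    have [simp]: "final_task T j = Exec j" "final_task T k = Exec k"
      using jk by (auto simp: final_task_def)
    \<comment> \<open>There are six interleavings. The bound 3/2 (t_j + p_j) is for the order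
      \<open>Test j\<close>, \<open>Test k\<close>, \<open>Exec j\<close>, \<open>Exec k\<close>; in
      the other five the delay is at most 2 t_j + p_j.\<close>
    have "position xs (Exec j) < position xs (Test k) \<or>
      position xs (Exec k) < position xs (Test j) \<or>
      (position xs (Test j) < position xs (Test k) \<and> position xs (Test k) < position xs (Exec j) \<and>
        (position xs (Exec j) < position xs (Exec k) \<or> position xs (Exec k) < position xs (Exec j))) \<or>
      (position xs (Test k) < position xs (Test j) \<and> position xs (Test j) < position xs (Exec k) \<and>
        (position xs (Exec j) < position xs (Exec k) \<or> position xs (Exec k) < position xs (Exec j)))"
      using jk
        neq[of "Test j" "Test k"] neq[of "Test j" "Exec k"] neq[of "Exec j" "Test k"] neq[of "Exec j" "Exec k"]
      by (simp add: job_tasks_def) linarith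
    then show ?thesis
      using pos TE[OF jk(1)] TE[OF jk(2)] jk
        wT[of "Test j" k] wT[of "Test k" j] wT[of "Exec k" j] wT[of "Exec j" k]
        wE[of k "Exec j"] wE[of j "Exec k"] wE[of j "Test k"] wE[of k "Test j"]
      by (elim disjE conjE) (auto simp: job_bound_def le_max_iff_disj)
  next
    assume jk: "j \<in> T" "k \<notin> T"
    note [simp] = work_before_tested[OF jk(1)] work_before_untested[OF jk(2)]
    have [simp]: "final_task T j = Exec j" "final_task T k = Untested k"
      using jk by (auto simp: final_task_def)
    \<comment> \<open>If k runs before the test of j, then u_k <= 2 t_j. If it runs between test and
      execution of j, then u_k <= t_j + p_j, and the test of j adds t_j.\<close>
    show ?thesis
      using pos TE[OF jk(1)] jk neq[of "Test j" "Untested k"] neq[of "Exec j" "Untested k"]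
        wT[of "Untested k" j] wE[of j "Untested k"]
      by (auto simp: job_bound_def job_tasks_def le_max_iff_disj)
  next
    assume jk: "j \<notin> T" "k \<in> T"
    note [simp] = work_before_untested[OF jk(1)] work_before_tested[OF jk(2)]
    have [simp]: "final_task T j = Untested j" "final_task T k = Exec k"
      using jk by (auto simp: final_task_def)
    \<comment> \<open>In the worst order j runs between test and execution of k: the delay is t_k +
      u_j with 2 t_k <= u_j.\<close>
    show ?thesis
      using pos TE[OF jk(2)] jk neq[of "Untested j" "Test k"] neq[of "Untested j" "Exec k"]
        wU[of "Test k" j] wU[of "Exec k" j] j
      by (auto simp: job_bound_def job_tasks_def le_max_iff_disj)
  next
    assume jk: "j \<notin> T" "k \<notin> T"
    note [simp] = work_before_untested[OF jk(1)] work_before_untested[OF jk(2)]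
    have [simp]: "final_task T j = Untested j" "final_task T k = Untested k"
      using jk by (auto simp: final_task_def)
    show ?thesis
      using pos jk neq[of "Untested j" "Untested k"] wU[of "Untested k" j] j
      by (auto simp: job_bound_def job_tasks_def le_max_iff_disj)
  qed
qed

text \<open>The choice depends on the instance and not on the coins, so it is fixed before
  expectations are taken.\<close>

definition cheaper :: "sched_inst \<Rightarrow> nat \<Rightarrow> nat \<Rightarrow> nat" where
  "cheaper I j k = (if opt_time I j \<le> opt_time I k then j else k)"

lemma cheaper_cases: "cheaper I j k = j \<or> cheaper I j k = k"
  by (simp add: cheaper_def)

lemma opt_bound_eq_cheaper:
  "opt_bound I = (\<Sum>j<njobs I. opt_time I j) + (\<Sum>j<njobs I. \<Sum>k<j. opt_time I (cheaper I j k))"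
  unfolding opt_bound_def by (intro arg_cong2[where f = "(+)"] sum.cong) (auto simp: cheaper_def)

lemma cost_queue_run_le:
  assumes "valid_inst I" "T \<subseteq> jobs I" "queue_run 2 I (initial_queue I T) xs"
  shows "cost I (T, list_start I xs)
    \<le> (\<Sum>j<njobs I. job_bound I T j) + (\<Sum>j<njobs I. \<Sum>k<j. job_bound I T (cheaper I j k))"
  unfolding cost_queue_run[OF assms(2,3)] sum_square_eq_sum_pairs
proof (intro add_mono sum_mono)
  fix j assume "j \<in> {..<njobs I}"
  then have j: "j \<in> jobs I"
    by (simp add: jobs_def)
  show "work_before I T xs j j \<le> job_bound I T j"
    using work_before_self_le[OF assms(1) j] .
  fix k assume "k \<in> {..<j}"
  then have "k \<in> jobs I" "j \<noteq> k"
    using j by (auto simp: jobs_def)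
  then show "work_before I T xs j k + work_before I T xs k j \<le> job_bound I T (cheaper I j k)"
    using work_before_pair_le[OF assms(1), of j k T xs] work_before_pair_le[OF assms(1), of k j T xs]
      assms(2,3) j cheaper_cases[of I j k] by (auto simp: add.commute)
qed

section \<open>Expected cost\<close>

lemma nn_integral_job_bound:
  assumes valid: "valid_inst I" and j: "j \<in> jobs I"
  shows "(\<integral>\<^sup>+ T. ennreal (job_bound I T j) \<partial>measure_pmf (test_set_pmf I (test_prob I)))
    \<le> ennreal (rpcp_ratio * opt_time I j)"
proof -
  let ?p = "test_prob I j"
  \<comment> \<open>\<open>job_bound\<close> as a function of the coin of \<open>j\<close>, with
    \<open>{j}\<close> and \<open>{}\<close> as representative test sets. The marginal of the
    product law then reduces the integral to a Bernoulli expectation.\<close>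
  define g where "g b = job_bound I (if b then {j} else {}) j" for b
  have p: "0 \<le> ?p" "?p \<le> 1"
    by (simp_all add: test_prob_eq prob_of_ratio_nonneg prob_of_ratio_le_1)
  have job_bound_Collect: "job_bound I {i. b i} j = g (b j)" for b
    by (simp add: g_def job_bound_def)
  have g: "0 \<le> g b" for b
    by (simp add: g_def job_bound_nonneg[OF valid j])
  have "(\<integral>\<^sup>+ T. ennreal (job_bound I T j) \<partial>measure_pmf (test_set_pmf I (test_prob I)))
      = (\<integral>\<^sup>+ b. ennreal (g (b j)) \<partial>measure_pmf (Pi_pmf (jobs I) False (\<lambda>j. bernoulli_pmf (test_prob I j))))"
    by (simp add: test_set_pmf_def job_bound_Collect)
  also have "\<dots> = (\<integral>\<^sup>+ b. ennreal (g b) \<partial>measure_pmf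
      (map_pmf (\<lambda>b. b j) (Pi_pmf (jobs I) False (\<lambda>j. bernoulli_pmf (test_prob I j)))))"
    by simp
  also have "\<dots> = (\<integral>\<^sup>+ b. ennreal (g b) \<partial>measure_pmf (bernoulli_pmf ?p))"
    using j by (simp add: Pi_pmf_component)
  also have "\<dots> = ennreal (?p * g True + (1 - ?p) * g False)"
    using p g by (simp add: ennreal_mult' mult.commute)
  also have "?p * g True + (1 - ?p) * g False \<le> rpcp_ratio * opt_time I j"
  proof -
    define t u q where "t = test_time I j" and "u = upper I j" and "q = proc_time I j"
    have pos: "0 < t" "0 < u" "0 \<le> q" "q \<le> u"
      using valid j by (auto simp: valid_inst_def t_def u_def q_def)
    \<comment> \<open>Scaling back: the normalized inequality is multiplied by the test
      time.\<close>
    have "t * (prob_of_ratio (u / t) * max (2 + q / t) (3 / 2 * (1 + q / t))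
          + (1 - prob_of_ratio (u / t)) * (3 / 2 * (u / t)))
        \<le> t * (rpcp_ratio * min (u / t) (1 + q / t))"
      using single_job_ratio_normalized[of "u / t" "q / t"] pos
      by (intro mult_left_mono) (auto simp: divide_right_mono)
    moreover have "t * max (2 + q / t) (3 / 2 * (1 + q / t)) = max (2 * t + q) (3 / 2 * (t + q))"
      using pos by (subst max_mult_distrib_left) (simp add: distrib_left)
    moreover have "t * min (u / t) (1 + q / t) = min u (t + q)"
      using pos by (subst min_mult_distrib_left) (simp add: distrib_left)
    moreover have "t * (x * m + y * (3 / 2 * (u / t))) = x * (t * m) + y * (3 / 2 * u)" for x y m
      using pos by (simp add: distrib_left)
    moreover have "t * (rpcp_ratio * m) = rpcp_ratio * (t * m)" for m
      by simp
    ultimately show ?thesis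
      by (simp only: g_def job_bound_def opt_time_def test_prob_eq if_True if_False singleton_iff simp_thms
          empty_iff flip: t_def u_def q_def)
  qed
  finally show ?thesis
    by (simp add: ennreal_leI)
qed

text \<open>Moves \<open>ennreal\<close> inside the sums, so that linearity of the nonnegative
  integral applies.\<close>

lemma ennreal_sum_pairs:
  fixes f :: "nat \<Rightarrow> real" and h :: "nat \<Rightarrow> nat \<Rightarrow> real"
  assumes "\<And>j. j < n \<Longrightarrow> 0 \<le> f j" "\<And>j k. j < n \<Longrightarrow> k < j \<Longrightarrow> 0 \<le> h j k"
  shows "ennreal ((\<Sum>j<n. f j) + (\<Sum>j<n. \<Sum>k<j. h j k))
    = (\<Sum>j<n. ennreal (f j)) + (\<Sum>j<n. \<Sum>k<j. ennreal (h j k))"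
proof -
  have f: "(\<Sum>j<n. ennreal (f j)) = ennreal (\<Sum>j<n. f j)"
    using assms by (intro sum_ennreal) auto
  have h: "(\<Sum>k<j. ennreal (h j k)) = ennreal (\<Sum>k<j. h j k)" if "j < n" for j
    using assms that by (intro sum_ennreal) auto
  have "(\<Sum>j<n. \<Sum>k<j. ennreal (h j k)) = (\<Sum>j<n. ennreal (\<Sum>k<j. h j k))"
    using h by (intro sum.cong) auto
  also have "\<dots> = ennreal (\<Sum>j<n. \<Sum>k<j. h j k)"
    using assms by (intro sum_ennreal sum_nonneg) auto
  finally show ?thesis
    unfolding f using assms by (simp only:) (intro ennreal_plus sum_nonneg; auto)
qed

lemma expected_cost_rpcp_le:
  assumes A: "is_rpcp 2 test_prob A" and valid: "valid_inst I"
  shows "expected_cost A I \<le> ennreal rpcp_ratio * ennreal (opt_cost I)"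
proof -
  let ?n = "njobs I"
  have fst_A: "map_pmf fst (A I) = test_set_pmf I (test_prob I)"
    and run: "\<And>T s. (T, s) \<in> set_pmf (A I) \<Longrightarrow>
      \<exists>xs. queue_run 2 I (initial_queue I T) xs \<and> s = list_start I xs"
    using A valid unfolding is_rpcp_def by blast+
  \<comment> \<open>Coins outside \<open>jobs I\<close> have the default value \<open>False\<close>
    of \<open>Pi_pmf\<close>.\<close>
  have T: "T \<subseteq> jobs I" if "(T, s) \<in> set_pmf (A I)" for T s
  proof -
    have "T \<in> set_pmf (map_pmf fst (A I))"
      using that by force
    then show ?thesis
      unfolding fst_A test_set_pmf_def
      using set_Pi_pmf_subset'[OF finite_jobs[of I], of False "\<lambda>j. bernoulli_pmf (test_prob I j)"]
      by (auto simp: PiE_dflt_def)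
  qed
  have E: "(\<integral>\<^sup>+ S. ennreal (job_bound I (fst S) j) \<partial>measure_pmf (A I)) \<le> ennreal (rpcp_ratio * opt_time I j)"
    if "j < ?n" for j
    using nn_integral_job_bound[OF valid, of j] that unfolding fst_A[symmetric] by (simp add: jobs_def)
  have b: "0 \<le> job_bound I T j" if "j < ?n" for T j
    using job_bound_nonneg[OF valid] that by (simp add: jobs_def)
  have cheaper_less: "cheaper I j k < ?n" if "j < ?n" "k < j" for j k
    using that cheaper_cases[of I j k] by auto
  have o: "0 \<le> rpcp_ratio * opt_time I j" if "j < ?n" for j
    using opt_time_pos[OF valid, of j] that rpcp_ratio_ge_2 by (simp add: jobs_def)
  \<comment> \<open>The pointwise bound depends on the test set \<open>fst S\<close> alone. This
    removes the tie-breaking and leaves only the known distribution of the coins.\<close>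
  have "expected_cost A I \<le> (\<integral>\<^sup>+ S. ennreal ((\<Sum>j<?n. job_bound I (fst S) j)
      + (\<Sum>j<?n. \<Sum>k<j. job_bound I (fst S) (cheaper I j k))) \<partial>measure_pmf (A I))"
    unfolding expected_cost_def
  proof (intro nn_integral_mono_AE AE_pmfI ennreal_leI)
    fix S assume S: "S \<in> set_pmf (A I)"
    obtain T s where Ts: "S = (T, s)" by force
    obtain xs where "queue_run 2 I (initial_queue I T) xs" "s = list_start I xs"
      using run S Ts by blast
    then show "cost I S \<le> (\<Sum>j<?n. job_bound I (fst S) j)
      + (\<Sum>j<?n. \<Sum>k<j. job_bound I (fst S) (cheaper I j k))"
      using cost_queue_run_le[OF valid T] S Ts by auto
  qed
  also have "\<dots> = (\<integral>\<^sup>+ S. (\<Sum>j<?n. ennreal (job_bound I (fst S) j))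
      + (\<Sum>j<?n. \<Sum>k<j. ennreal (job_bound I (fst S) (cheaper I j k))) \<partial>measure_pmf (A I))"
    using b cheaper_less by (intro nn_integral_cong ennreal_sum_pairs) auto
  also have "\<dots> = (\<Sum>j<?n. \<integral>\<^sup>+ S. ennreal (job_bound I (fst S) j) \<partial>measure_pmf (A I))
      + (\<Sum>j<?n. \<Sum>k<j. \<integral>\<^sup>+ S. ennreal (job_bound I (fst S) (cheaper I j k)) \<partial>measure_pmf (A I))"
    by (simp add: nn_integral_add nn_integral_sum)
  also have "\<dots> \<le> (\<Sum>j<?n. ennreal (rpcp_ratio * opt_time I j))
      + (\<Sum>j<?n. \<Sum>k<j. ennreal (rpcp_ratio * opt_time I (cheaper I j k)))"
    using E cheaper_less by (intro add_mono sum_mono) auto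
  also have "\<dots> = ennreal (rpcp_ratio * opt_bound I)"
    unfolding opt_bound_eq_cheaper distrib_left sum_distrib_left
    using o cheaper_less by (intro ennreal_sum_pairs[symmetric]) auto
  also have "\<dots> \<le> ennreal (rpcp_ratio * opt_cost I)"
    using opt_bound_le_opt_cost[OF valid] rpcp_ratio_ge_2 by (intro ennreal_leI mult_left_mono) auto
  also have "\<dots> = ennreal rpcp_ratio * ennreal (opt_cost I)"
    using rpcp_ratio_ge_2 by (intro ennreal_mult') auto
  finally show ?thesis .
qed

theorem corollary13:
  fixes A :: rand_alg
  assumes "is_rpcp 2 test_prob A"
  shows "expected_competitive_ratio A \<le> ennreal (3 * (7 + 3 * sqrt 6) / 20)
       \<and> 3 * (7 + 3 * sqrt 6) / 20 \<le> (2.152271 :: real)"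
proof
  show "expected_competitive_ratio A \<le> ennreal (3 * (7 + 3 * sqrt 6) / 20)"
    unfolding expected_competitive_ratio_def rpcp_ratio_def[symmetric]
    using expected_cost_rpcp_le[OF assms] by (intro Inf_lower) blast
  show "3 * (7 + 3 * sqrt 6) / 20 \<le> (2.152271 :: real)"
    using sqrt_6_bounds by simp
qed

end
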